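(* Let $G_n^{0,q}$ be a $(0,q)$-perturbed noisy random geometric graph in the standard setting described in the context, and suppose that $nr^d\le n^{-\alpha}$ for some fixed $\alpha\in(0,1/\beta^2]$. Then: (a) There exist constants $C_1,C_2>0$ depending on $\beta$ and $\alpha$ such that if $q\le C_1(1/n)^{C_2}$, then there is a constant $K$ such that with high probability, every long-edge $(u,v)$ of $G_n^{0,q}$ satisfies $\omega_{u,v}(G_n^{0,q})\le K$ (i.e. $\omega_{u,v}(G_n^{0,q})\lesssim 1$ for all long-edges). (b) There exists a constant $\xi>0$ depending on $\beta$ and $\alpha$ such that if $(1/n)^{\xi}\le q<1$, then there is a constant $C$ such that with high probability, every long-edge $(u,v)$ of $G_n^{0,q}$ satisfies $\omega_{u,v}(G_n^{0,q})\le C\log_{1/q} n$.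
   Context: Standard setting: fix an integer $d\ge 1$ and an arbitrary norm $\|\cdot\|$ on $\mathbb{R}^d$. Let $\nu$ be a probability distribution on $\mathbb{R}^d$ with a bounded density. Let $X_1,X_2,\dots$ be i.i.d. with law $\nu$, and let $r=r(n)>0$ with $r(n)\to 0$. $G_n$ is the random geometric graph on $\{X_1,\dots,X_n\}$ in which distinct $X_i,X_j$ are adjacent iff $\|X_i-X_j\|\le r(n)$. $G_n^{0,q}$ is obtained from $G_n$ by inserting each non-edge of $G_n$ independently with probability $q=q(n)$ (no deletions). A long-edge of $G_n^{0,q}$ is an edge $(u,v)$ with $\|u-v\|>3r$. For a graph $G$ and an edge $(u,v)$, the edge clique number $\omega_{u,v}(G)$ is the largest size of a clique in $G$ containing both $u$ and $v$. "With high probability" means with probability tending to $1$ as $n\to\infty$. Besicovitch constant: a $\delta$-packing with respect to $P\subseteq\mathbb{R}^d$ is a countable collection of pairwise disjoint closed balls of radius $\delta$ centered at points of $P$; $\beta=\beta(d)\in\mathbb{N}$ is a constant such that for every $P\subseteq\mathbb{R}^d$ and $\delta>0$ there are $\beta$ $\delta$-packings with respect to $P$ whose union covers $P$. *)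

theory Defs
  imports "HOL-Probability.Probability" "HOL-Library.Ramsey"
begin

text \<open>
  The dimension \<open>d\<close> is a natural number rather than a type, because the constants of the theorem
  depend on \<open>\<beta>\<close> and \<open>\<alpha>\<close> only, so \<open>d\<close> has to be quantified after them. A point of \<open>d\<close>-dimensional
  space is an extensional function on \<open>{..<d}\<close>.
\<close>

abbreviation Leb :: "nat \<Rightarrow> (nat \<Rightarrow> real) measure" where
  "Leb d \<equiv> Pi\<^sub>M {..<d} (\<lambda>_. lborel)"

abbreviation Rd :: "nat \<Rightarrow> (nat \<Rightarrow> real) set" where
  "Rd d \<equiv> {..<d} \<rightarrow>\<^sub>E (UNIV :: real set)"

definition is_norm :: "nat \<Rightarrow> ((nat \<Rightarrow> real) \<Rightarrow> real) \<Rightarrow> bool" where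
  "is_norm d N \<longleftrightarrow>
     (\<forall>x \<in> Rd d. 0 \<le> N x \<and> (N x = 0 \<longleftrightarrow> (\<forall>k<d. x k = 0))) \<and>
     (\<forall>x \<in> Rd d. \<forall>c. N (\<lambda>k\<in>{..<d}. c * x k) = \<bar>c\<bar> * N x) \<and>
     (\<forall>x \<in> Rd d. \<forall>y \<in> Rd d. N (\<lambda>k\<in>{..<d}. x k + y k) \<le> N x + N y)"

definition ndist :: "nat \<Rightarrow> ((nat \<Rightarrow> real) \<Rightarrow> real) \<Rightarrow> (nat \<Rightarrow> real) \<Rightarrow> (nat \<Rightarrow> real) \<Rightarrow> real" where
  "ndist d N x y = N (\<lambda>k\<in>{..<d}. x k - y k)"

definition nball :: "nat \<Rightarrow> ((nat \<Rightarrow> real) \<Rightarrow> real) \<Rightarrow> (nat \<Rightarrow> real) \<Rightarrow> real \<Rightarrow> (nat \<Rightarrow> real) set" where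
  "nball d N x \<delta> = {y \<in> Rd d. ndist d N x y \<le> \<delta>}"

definition packing ::
  "nat \<Rightarrow> ((nat \<Rightarrow> real) \<Rightarrow> real) \<Rightarrow> real \<Rightarrow> (nat \<Rightarrow> real) set \<Rightarrow> (nat \<Rightarrow> real) set set \<Rightarrow> bool" where
  "packing d N \<delta> P \<B> \<longleftrightarrow>
     countable \<B> \<and> \<B> \<subseteq> (\<lambda>p. nball d N p \<delta>) ` P \<and> pairwise disjnt \<B>"

definition besicovitch_constant :: "nat \<Rightarrow> ((nat \<Rightarrow> real) \<Rightarrow> real) \<Rightarrow> nat \<Rightarrow> bool" where
  "besicovitch_constant d N \<beta> \<longleftrightarrow>
     (\<forall>P \<subseteq> Rd d. \<forall>\<delta>>0. \<exists>\<B> :: nat \<Rightarrow> (nat \<Rightarrow> real) set set.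
        (\<forall>i<\<beta>. packing d N \<delta> P (\<B> i)) \<and> P \<subseteq> (\<Union>i<\<beta>. \<Union>(\<B> i)))"

definition has_bounded_density :: "nat \<Rightarrow> (nat \<Rightarrow> real) measure \<Rightarrow> bool" where
  "has_bounded_density d \<nu> \<longleftrightarrow>
     (\<exists>(f :: (nat \<Rightarrow> real) \<Rightarrow> real) B. f \<in> borel_measurable (Leb d) \<and>
        (\<forall>x \<in> Rd d. 0 \<le> f x \<and> f x \<le> B) \<and> \<nu> = density (Leb d) (\<lambda>x. ennreal (f x)))"

definition standard_setting ::
  "nat \<Rightarrow> ((nat \<Rightarrow> real) \<Rightarrow> real) \<Rightarrow> (nat \<Rightarrow> real) measure \<Rightarrow> (nat \<Rightarrow> real) \<Rightarrow> bool" where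
  "standard_setting d N \<nu> r \<longleftrightarrow>
     1 \<le> d \<and> is_norm d N \<and> prob_space \<nu> \<and> has_bounded_density d \<nu> \<and>
     (\<forall>n. 0 < r n) \<and> r \<longlonglongrightarrow> 0"

text \<open>
  Graphs have the index set \<open>{..<n}\<close> as vertex set, vertex \<open>i\<close> standing for the point \<open>X i\<close>
  (the points are almost surely distinct); edges are two-element sets of indices.
\<close>

definition rgg_edges ::
  "nat \<Rightarrow> ((nat \<Rightarrow> real) \<Rightarrow> real) \<Rightarrow> real \<Rightarrow> nat \<Rightarrow> (nat \<Rightarrow> nat \<Rightarrow> real) \<Rightarrow> nat set set" where
  "rgg_edges d N \<rho> n X = {{i, j} | i j. i < n \<and> j < n \<and> i \<noteq> j \<and> ndist d N (X i) (X j) \<le> \<rho>}"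

text \<open>
  An outcome is a pair of the sample \<open>X\<close> and of one coin \<open>W e\<close> with success probability \<open>q\<close> for
  every pair \<open>e\<close> of vertices, all independent. Only the coins of the non-edges of the random
  geometric graph are used, so given \<open>X\<close> each non-edge is inserted independently with
  probability \<open>q\<close>.
\<close>

type_synonym outcome = "(nat \<Rightarrow> nat \<Rightarrow> real) \<times> (nat set \<Rightarrow> bool)"

definition noisy_space :: "(nat \<Rightarrow> real) measure \<Rightarrow> real \<Rightarrow> nat \<Rightarrow> outcome measure" where
  "noisy_space \<nu> p n =
     (Pi\<^sub>M {..<n} (\<lambda>_. \<nu>)) \<Otimes>\<^sub>M (Pi\<^sub>M (nsets {..<n} 2) (\<lambda>_. measure_pmf (bernoulli_pmf p)))"

definition noisy_edges ::
  "nat \<Rightarrow> ((nat \<Rightarrow> real) \<Rightarrow> real) \<Rightarrow> real \<Rightarrow> nat \<Rightarrow> outcome \<Rightarrow> nat set set" where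
  "noisy_edges d N \<rho> n \<omega> =
     rgg_edges d N \<rho> n (fst \<omega>) \<union> {e \<in> nsets {..<n} 2 - rgg_edges d N \<rho> n (fst \<omega>). snd \<omega> e}"

definition long_edge ::
  "nat \<Rightarrow> ((nat \<Rightarrow> real) \<Rightarrow> real) \<Rightarrow> real \<Rightarrow> nat \<Rightarrow> outcome \<Rightarrow> nat \<Rightarrow> nat \<Rightarrow> bool" where
  "long_edge d N \<rho> n \<omega> u v \<longleftrightarrow>
     {u, v} \<in> noisy_edges d N \<rho> n \<omega> \<and> ndist d N (fst \<omega> u) (fst \<omega> v) > 3 * \<rho>"

text \<open>
  The set of cliques below is finite for finite \<open>V\<close>, and nonempty when \<open>{u, v}\<close> is an edge; the
  value is not meaningful otherwise.
\<close>

definition edge_clique_number :: "'a set \<Rightarrow> 'a set set \<Rightarrow> 'a \<Rightarrow> 'a \<Rightarrow> nat" where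
  "edge_clique_number V E u v = Max {card S | S. S \<subseteq> V \<and> clique S E \<and> u \<in> S \<and> v \<in> S}"

definition with_high_probability :: "(nat \<Rightarrow> 'a measure) \<Rightarrow> (nat \<Rightarrow> 'a \<Rightarrow> bool) \<Rightarrow> bool" where
  "with_high_probability M P \<longleftrightarrow> (\<lambda>n. \<P>(\<omega> in M n. P n \<omega>)) \<longlonglongrightarrow> 1"

end

theory Submission
  imports Defs
begin

text \<open>
  In the sparse regime the degrees of the random geometric graph are bounded: a ball of radius
  \<open>r\<close> has mass at most \<open>c r\<^sup>d\<close>, so some point has \<open>k\<close> others within distance \<open>r\<close> with
  probability at most \<open>n (n c r\<^sup>d)\<^sup>k \<le> c\<^sup>k n powr (1 - \<alpha> k)\<close>, which vanishes for \<open>k \<ge> 2 / \<alpha>\<close>.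
  When all degrees are below \<open>k\<close>, a set of \<open>s = 4 t + 1 + k\<close> vertices contains at least \<open>s t\<close>
  non-edges of the geometric graph, all of which must be inserted for it to become a clique. A union
  bound over these sets gives probability at most \<open>(n q\<^sup>t)\<^sup>s\<close> for a clique of size \<open>s\<close>, which
  vanishes as soon as \<open>n\<^sup>2 q\<^sup>t \<le> 1\<close>. A constant \<open>t\<close> suffices for (a), and \<open>t\<close> about
  \<open>2 log\<^bsub>1/q\<^esub> n\<close> for (b).
\<close>

subsection \<open>Norms and balls\<close>

lemma is_normD:
  assumes "is_norm d N" "x \<in> Rd d"
  shows "0 \<le> N x" "N x = 0 \<longleftrightarrow> (\<forall>k<d. x k = 0)" "N (\<lambda>k\<in>{..<d}. c * x k) = \<bar>c\<bar> * N x"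
    "y \<in> Rd d \<Longrightarrow> N (\<lambda>k\<in>{..<d}. x k + y k) \<le> N x + N y"
  using assms unfolding is_norm_def by blast+

text \<open>Expand \<open>x\<close> in the standard basis and apply the triangle inequality one
  coordinate at a time. The resulting weighted sum of coordinates is what makes every norm
  Lipschitz.\<close>

lemma is_norm_le_sum:
  assumes N: "is_norm d N"
  shows "N (restrict x {..<d}) \<le> (\<Sum>k<d. \<bar>x k\<bar> * N (\<lambda>j\<in>{..<d}. of_bool (j = k)))"
proof -
  \<comment> \<open>\<open>T m\<close> keeps the first \<open>m\<close> coordinates and zeroes the
    others, so each induction step adds one multiple of a basis vector.\<close>
  define T where "T m = (\<lambda>k\<in>{..<d}. if k < m then x k else 0)" for m
  have "m \<le> d \<Longrightarrow> N (T m) \<le> (\<Sum>k<m. \<bar>x k\<bar> * N (\<lambda>j\<in>{..<d}. of_bool (j = k)))" for m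
  proof (induction m)
    case 0
    have "N (T 0) = 0"
      using is_normD(2)[OF N, of "T 0"] by (auto simp: T_def)
    then show ?case by simp
  next
    case (Suc m)
    define e where "e = (\<lambda>j\<in>{..<d}. of_bool (j = m) :: real)"
    define y where "y = (\<lambda>k\<in>{..<d}. x m * e k)"
    have mem: "T m \<in> Rd d" "e \<in> Rd d" "y \<in> Rd d"
      by (auto simp: T_def e_def y_def)
    have "T (Suc m) = (\<lambda>k\<in>{..<d}. T m k + y k)"
      by (auto simp: T_def e_def y_def fun_eq_iff less_Suc_eq)
    then have "N (T (Suc m)) \<le> N (T m) + N y"
      using is_normD(4)[OF N mem(1,3)] by (simp only:)
    moreover have "N y = \<bar>x m\<bar> * N e"
      unfolding y_def by (rule is_normD(3)[OF N mem(2)])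
    moreover have "N (T m) \<le> (\<Sum>k<m. \<bar>x k\<bar> * N (\<lambda>j\<in>{..<d}. of_bool (j = k)))"
      using Suc.IH Suc_leD[OF Suc.prems] by blast
    ultimately show ?case unfolding sum.lessThan_Suc e_def[symmetric] by linarith
  qed
  from this[of d] show ?thesis
    by (simp add: T_def restrict_def cong: if_cong)
qed

lemma is_norm_abs_diff_le:
  assumes N: "is_norm d N"
  shows "\<bar>N (restrict x {..<d}) - N (restrict y {..<d})\<bar>
    \<le> (\<Sum>k<d. \<bar>x k - y k\<bar> * N (\<lambda>j\<in>{..<d}. of_bool (j = k)))"
proof -
  have *: "N (restrict x {..<d}) - N (restrict y {..<d})
    \<le> (\<Sum>k<d. \<bar>x k - y k\<bar> * N (\<lambda>j\<in>{..<d}. of_bool (j = k)))" for x y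
  proof -
    define z where "z = restrict (\<lambda>k. x k - y k) {..<d}"
    define y' where "y' = restrict y {..<d}"
    have mem: "z \<in> Rd d" "y' \<in> Rd d"
      by (auto simp: z_def y'_def)
    have "restrict x {..<d} = (\<lambda>k\<in>{..<d}. z k + y' k)"
      by (simp add: fun_eq_iff z_def y'_def)
    then have "N (restrict x {..<d}) \<le> N z + N y'"
      using is_normD(4)[OF N mem] by (simp only:)
    moreover have "N z \<le> (\<Sum>k<d. \<bar>x k - y k\<bar> * N (\<lambda>j\<in>{..<d}. of_bool (j = k)))"
      unfolding z_def by (rule is_norm_le_sum[OF N])
    ultimately show ?thesis unfolding y'_def by linarith
  qed
  show ?thesis using *[of x y] *[of y x] 
    unfolding abs_minus_commute[of "y k" "x k" for k] by linarith
qed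

text \<open>The Lipschitz bound involves only finitely many coordinates, so it is continuous in the
  product topology and vanishes at \<open>x\<close>. \<open>restrict\<close> makes the norm a
  function on the whole type \<open>nat \<Rightarrow> real\<close>, where this topology
  lives.\<close>

lemma continuous_on_is_norm:
  assumes N: "is_norm d N"
  shows "continuous_on UNIV (\<lambda>x. N (restrict x {..<d}))"
  unfolding continuous_on_def
proof safe
  fix x :: "nat \<Rightarrow> real"
  let ?b = "\<lambda>y. \<Sum>k<d. \<bar>y k - x k\<bar> * N (\<lambda>j\<in>{..<d}. of_bool (j = k))"
  have "continuous_on UNIV ?b"
    by (intro continuous_intros continuous_on_product_coordinates)
  then have "isCont ?b x"
    using continuous_on_eq_continuous_at[OF open_UNIV] by fast
  then have "(?b \<longlongrightarrow> 0) (at x)"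
    unfolding isCont_def by simp
  then have "((\<lambda>y. N (restrict y {..<d}) - N (restrict x {..<d})) \<longlongrightarrow> 0) (at x)"
    by (rule Lim_null_comparison[rotated]) (simp add: is_norm_abs_diff_le[OF N] always_eventually)
  then show "((\<lambda>x. N (restrict x {..<d})) \<longlongrightarrow> N (restrict x {..<d})) (at x)"
    by (simp add: LIM_zero_iff)
qed

text \<open>Points of \<open>Rd d\<close> are padded with zeros to points of the full product, whose
  product sigma-algebra is the Borel one. There continuity yields measurability, and restricting to
  \<open>{..<d}\<close> recovers the original point.\<close>

lemma is_norm_measurable:
  assumes N: "is_norm d N"
  shows "N \<in> borel_measurable (Leb d)"
proof -
  have g: "(\<lambda>x. N (restrict x {..<d})) \<in> borel_measurable (Pi\<^sub>M UNIV (\<lambda>_. borel))"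
    using borel_measurable_continuous_onI[OF continuous_on_is_norm[OF N]]
    by (simp cong: measurable_cong_sets add: sets_PiM_equal_borel)
  have "(\<lambda>x k. if k < d then x k else 0 :: real) \<in> measurable (Leb d) (Pi\<^sub>M UNIV (\<lambda>_. borel))"
  proof (rule measurable_PiM_single')
    fix k :: nat
    show "(\<lambda>x. if k < d then x k else 0) \<in> borel_measurable (Leb d)"
    proof (cases "k < d")
      case True
      then have "(\<lambda>x. x k) \<in> measurable (Leb d) lborel"
        by (intro measurable_component_singleton) simp
      with True show ?thesis by simp
    qed simp
  qed simp
  from measurable_compose[OF this g]
  have "(\<lambda>x. N (restrict (\<lambda>k. if k < d then x k else 0) {..<d})) \<in> borel_measurable (Leb d)" .
  also have "?this \<longleftrightarrow> ?thesis"
    by (rule measurable_cong) (auto simp: space_PiM restrict_def PiE_iff extensional_def intro!: arg_cong[where f=N])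
  finally show ?thesis .
qed

lemma ndist_measurable:
  assumes N: "is_norm d N"
    and "f \<in> measurable M (Leb d)" "g \<in> measurable M (Leb d)"
  shows "(\<lambda>x. ndist d N (f x) (g x)) \<in> borel_measurable M"
proof -
  have "(\<lambda>x. \<lambda>k\<in>{..<d}. f x k - g x k) \<in> measurable M (Leb d)"
  proof (rule measurable_restrict)
    fix k assume "k \<in> {..<d}"
    then have "(\<lambda>x. x k) \<in> borel_measurable (Leb d)"
      using measurable_component_singleton[of k "{..<d}" "\<lambda>_. lborel"] by simp
    from measurable_compose[OF assms(2) this] measurable_compose[OF assms(3) this]
    show "(\<lambda>x. f x k - g x k) \<in> measurable M lborel" by simp
  qed
  from measurable_compose[OF this is_norm_measurable[OF N]] show ?thesis
    by (simp add: ndist_def)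
qed

section \<open>Comparison with the maximum norm and the mass of balls\<close>

lemma compact_box: "compact {x :: nat \<Rightarrow> real. \<forall>k. x k \<in> {-1..1}}"
proof -
  have "compactin (product_topology (\<lambda>_. euclideanreal) UNIV) (PiE UNIV (\<lambda>_::nat. {-1..1}))"
    by (subst compactin_PiE) simp
  moreover have "PiE UNIV (\<lambda>_::nat. {-1..1::real}) = {x. \<forall>k. x k \<in> {-1..1}}"
    by (auto simp: PiE_iff)
  ultimately show ?thesis by (simp add: euclidean_product_topology)
qed

text \<open>Equivalence of norms: by compactness \<open>N\<close> attains a positive minimum
  \<open>m\<close> on the sphere of the maximum norm, and homogeneity gives the bound with
  \<open>c = 1 / m\<close>. It serves to enclose norm balls in cubes.\<close>

lemma is_norm_coordinate_bound:
  assumes N: "is_norm d N"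
  obtains c where "c > 0" "\<And>x k. x \<in> Rd d \<Longrightarrow> k < d \<Longrightarrow> \<bar>x k\<bar> \<le> c * N x"
\<comment> \<open>For \<open>d = 0\<close> there is no coordinate to bound; the case is separate
  because the sphere below would be empty.\<close>
proof (cases "d = 0")
  case True
  then show ?thesis using that[of 1] by simp
next
  case False
  \<comment> \<open>The sphere of the maximum norm; the coordinates from \<open>d\<close> on are irrelevant and only kept bounded
    so that \<open>S\<close> is compact in the product topology.\<close>
  define S where "S = {x :: nat \<Rightarrow> real. \<forall>k. x k \<in> {-1..1}} \<inter> (\<Union>k<d. {x. \<bar>x k\<bar> = 1})"
  have "closed {x :: nat \<Rightarrow> real. \<bar>x k\<bar> = 1}" for k
    by (intro closed_Collect_eq continuous_intros continuous_on_product_coordinates)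
  then have "compact S"
    unfolding S_def by (intro compact_Int_closed compact_box closed_UN) auto
  moreover have "(\<lambda>_. 1) \<in> S" using False by (auto simp: S_def)
  moreover have "continuous_on S (\<lambda>x. N (restrict x {..<d}))"
    using continuous_on_subset[OF continuous_on_is_norm[OF N]] by simp
  ultimately obtain z where z: "z \<in> S" "\<And>x. x \<in> S \<Longrightarrow> N (restrict z {..<d}) \<le> N (restrict x {..<d})"
    using continuous_attains_inf[of S "\<lambda>x. N (restrict x {..<d})"] by blast
  define m where "m = N (restrict z {..<d})"
  have "m \<noteq> 0"
    using z(1) is_normD(2)[OF N, of "restrict z {..<d}"] by (auto simp: S_def m_def)
  then have m: "m > 0"
    using is_normD(1)[OF N, of "restrict z {..<d}"] by (auto simp: m_def)
  show ?thesis
  proof (rule that[of "1 / m"])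
    show "1 / m > 0" using m by simp
    fix x k assume x: "x \<in> Rd d" and k: "k < d"
    define M where "M = Max ((\<lambda>k. \<bar>x k\<bar>) ` {..<d})"
    have le: "\<bar>x j\<bar> \<le> M" if "j < d" for j
      unfolding M_def using that by (intro Max_ge) auto
    have "M \<in> (\<lambda>k. \<bar>x k\<bar>) ` {..<d}"
      unfolding M_def using False by (intro Max_in) auto
    then obtain i where i: "i < d" "M = \<bar>x i\<bar>" by auto
    show "\<bar>x k\<bar> \<le> 1 / m * N x"
    proof (cases "M = 0")
      case True
      then show ?thesis using le[OF k] m is_normD(1)[OF N x] by simp
    next
      case False
      then have M: "M > 0" using i by simp
      \<comment> \<open>Dividing by the largest coordinate and padding with zeros puts
        \<open>x\<close> on the sphere, where the norm is at least \<open>m\<close>.\<close>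
      let ?y = "\<lambda>k. if k < d then x k / M else 0"
      have "?y \<in> S"
        using le M i by (auto simp: S_def abs_le_iff field_simps intro!: bexI[of _ i])
           (metis abs_le_iff minus_le_iff)
      then have "m \<le> N (restrict ?y {..<d})" using z by (simp add: m_def)
      also have "restrict ?y {..<d} = (\<lambda>k\<in>{..<d}. (1 / M) * x k)" by auto
      also have "N \<dots> = \<bar>1 / M\<bar> * N x" by (rule is_normD(3)[OF N x])
      finally have "m * M \<le> N x" using M by (simp add: field_simps)
      then show ?thesis using le[OF k] m
        using mult_left_mono[OF le[OF k], of m] order_trans[of "m * \<bar>x k\<bar>" "m * M" "N x"]
        by (simp add: field_simps)
    qed
  qed
qed

text \<open>A ball of radius \<open>\<rho>\<close> lies in a cube of side
  \<open>2 * c * \<rho>\<close>, and the mass of the cube is at most its volume times a bound of the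
  density.\<close>

lemma bounded_density_ball_le:
  assumes N: "is_norm d N" and \<nu>: "has_bounded_density d \<nu>"
  obtains c where "c > 0"
    "\<And>x \<rho>. x \<in> Rd d \<Longrightarrow> \<rho> > 0 \<Longrightarrow> emeasure \<nu> (nball d N x \<rho>) \<le> ennreal (c * \<rho> ^ d)"
proof -
  obtain f B where f: "f \<in> borel_measurable (Leb d)" "\<And>x. x \<in> Rd d \<Longrightarrow> 0 \<le> f x \<and> f x \<le> B"
    and \<nu>_eq: "\<nu> = density (Leb d) (\<lambda>x. ennreal (f x))"
    using \<nu> unfolding has_bounded_density_def by blast
  obtain c where c: "c > 0" "\<And>x k. x \<in> Rd d \<Longrightarrow> k < d \<Longrightarrow> \<bar>x k\<bar> \<le> c * N x"
    using is_norm_coordinate_bound[OF N] by blast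
  interpret L: product_sigma_finite "\<lambda>_::nat. lborel :: real measure" ..
  show ?thesis
  \<comment> \<open>\<open>\<bar>B\<bar> + 1\<close> still bounds the density and is positive
    whatever the sign of \<open>B\<close>.\<close>
  proof (rule that[of "(\<bar>B\<bar> + 1) * (2 * c) ^ d"])
    show "(\<bar>B\<bar> + 1) * (2 * c) ^ d > 0" using c by (simp add: add_nonneg_pos)
    fix x \<rho> assume x: "x \<in> Rd d" and \<rho>: "(\<rho>::real) > 0"
    let ?b = "PiE {..<d} (\<lambda>k. {x k - c * \<rho> .. x k + c * \<rho>})"
    have sub: "nball d N x \<rho> \<subseteq> ?b"
    proof
      fix y assume "y \<in> nball d N x \<rho>"
      then have y: "y \<in> Rd d" "ndist d N x y \<le> \<rho>" by (auto simp: nball_def)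
      have "\<bar>x k - y k\<bar> \<le> c * \<rho>" if "k < d" for k
      proof -
        have "\<bar>x k - y k\<bar> \<le> c * ndist d N x y"
          using c(2)[of "\<lambda>k\<in>{..<d}. x k - y k" k] that by (simp add: ndist_def)
        also have "\<dots> \<le> c * \<rho>" using y c(1) by simp
        finally show ?thesis .
      qed
      then show "y \<in> ?b" using y(1) by (force simp: PiE_iff abs_le_iff)
    qed
    have b: "?b \<in> sets (Leb d)" by (intro sets_PiM_I_finite) auto
    have "emeasure \<nu> (nball d N x \<rho>) \<le> emeasure \<nu> ?b"
      using b sub by (intro emeasure_mono) (auto simp: \<nu>_eq)
    also have "\<dots> = (\<integral>\<^sup>+ z. ennreal (f z) * indicator ?b z \<partial>Leb d)"
      unfolding \<nu>_eq using f(1) b by (intro emeasure_density) auto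
    also have "\<dots> \<le> (\<integral>\<^sup>+ z. ennreal (\<bar>B\<bar> + 1) * indicator ?b z \<partial>Leb d)"
      using f(2) by (intro nn_integral_mono mult_right_mono ennreal_leI)
        (force simp: space_PiM, simp)
    also have "\<dots> = ennreal (\<bar>B\<bar> + 1) * emeasure (Leb d) ?b"
      using b by (simp add: nn_integral_cmult_indicator)
    also have "emeasure (Leb d) ?b = (\<Prod>k<d. ennreal (2 * (c * \<rho>)))"
      using c \<rho> by (subst L.emeasure_PiM) (auto intro!: prod.cong simp: mult_ac)
    also have "\<dots> = ennreal ((2 * (c * \<rho>)) ^ d)"
      using c \<rho> by (simp add: ennreal_power)
    also have "ennreal (\<bar>B\<bar> + 1) * \<dots> = ennreal ((\<bar>B\<bar> + 1) * (2 * c) ^ d * \<rho> ^ d)"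
      using c \<rho> by (subst ennreal_mult'[symmetric]) (simp_all add: power_mult_distrib mult_ac)
    finally show "emeasure \<nu> (nball d N x \<rho>) \<le> \<dots>" .
  qed
qed

subsection \<open>Degrees of the random geometric graph\<close>

lemma ndist_commute:
  assumes "is_norm d N"
  shows "ndist d N x y = ndist d N y x"
proof -
  define z where "z = (\<lambda>k\<in>{..<d}. x k - y k)"
  have "z \<in> Rd d" by (simp add: z_def)
  then have "N (\<lambda>k\<in>{..<d}. - 1 * z k) = \<bar>- 1\<bar> * N z"
    by (rule is_normD(3)[OF assms])
  moreover have "(\<lambda>k\<in>{..<d}. - 1 * z k) = (\<lambda>k\<in>{..<d}. y k - x k)"
    by (auto simp: z_def)
  ultimately show ?thesis by (simp add: ndist_def z_def)
qed

lemma doubleton_in_rgg_edges: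
  assumes "is_norm d N"
  shows "{i, j} \<in> rgg_edges d N \<rho> n X \<longleftrightarrow>
    i < n \<and> j < n \<and> i \<noteq> j \<and> ndist d N (X i) (X j) \<le> \<rho>"
  using ndist_commute[OF assms] unfolding rgg_edges_def by (auto simp: doubleton_eq_iff)

lemma doubleton_in_noisy_edges:
  assumes "is_norm d N"
  shows "{i, j} \<in> noisy_edges d N \<rho> n \<omega> \<longleftrightarrow>
    i < n \<and> j < n \<and> i \<noteq> j \<and> (ndist d N (fst \<omega> i) (fst \<omega> j) \<le> \<rho> \<or> snd \<omega> {i, j})"
  unfolding noisy_edges_def by (auto simp: doubleton_in_rgg_edges[OF assms] doubleton_in_nsets_2)

lemma noisy_edges_subset: "noisy_edges d N \<rho> n \<omega> \<subseteq> nsets {..<n} 2"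
  unfolding noisy_edges_def rgg_edges_def by (auto simp: doubleton_in_nsets_2)

text \<open>The bound on the mass of balls, which is how the density acts, is passed to the lemmas
  that need it as a hypothesis. The radius and the number of points thus stay free.\<close>

locale sampling =
  fixes d :: nat and N :: "(nat \<Rightarrow> real) \<Rightarrow> real" and \<nu> :: "(nat \<Rightarrow> real) measure"
  assumes is_norm: "is_norm d N" and prob_space_sample: "prob_space \<nu>"
    and sets_sample: "sets \<nu> = sets (Leb d)"
begin

lemma space_sample: "space \<nu> = Rd d"
  using sets_eq_imp_space_eq[OF sets_sample] by (simp add: space_PiM)

lemma ndist_measurable_sample:
  assumes "f \<in> measurable M \<nu>" "g \<in> measurable M \<nu>"
  shows "(\<lambda>x. ndist d N (f x) (g x)) \<in> borel_measurable M"
  using assms by (intro ndist_measurable[OF is_norm]) (simp_all cong: measurable_cong_sets add: sets_sample)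

text \<open>Given the point \<open>X i\<close>, the points indexed by \<open>J\<close> fall into its
  ball independently, each with probability at most \<open>p\<close>. Fubini integrates them out one
  by one; \<open>I\<close> varies in the induction because each integration removes an index from
  it.\<close>

lemma emeasure_all_close_le:
  assumes p: "\<And>x. x \<in> Rd d \<Longrightarrow> emeasure \<nu> (nball d N x \<rho>) \<le> p"
    and "finite J" "finite I" "J \<subseteq> I" "i \<in> I - J"
  shows "emeasure (Pi\<^sub>M I (\<lambda>_. \<nu>))
      {X \<in> space (Pi\<^sub>M I (\<lambda>_. \<nu>)). \<forall>j\<in>J. ndist d N (X i) (X j) \<le> \<rho>} \<le> p ^ card J"
  using assms(2-)
proof (induction J arbitrary: I rule: finite_induct)
  case empty
  interpret P: prob_space "Pi\<^sub>M I (\<lambda>_. \<nu>)"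
    by (rule prob_space_PiM) (rule prob_space_sample)
  show ?case by (simp add: P.emeasure_space_1)
next
  case (insert j J)
  interpret \<nu>: prob_space \<nu> by (rule prob_space_sample)
  interpret product_sigma_finite "\<lambda>_. \<nu>" ..
  define I' where "I' = I - {j}"
  have I: "I = insert j I'" "finite I'" "j \<notin> I'" "J \<subseteq> I'" "i \<in> I' - J"
    using insert.prems insert.hyps by (auto simp: I'_def)
  define A where "A J I = {X \<in> space (Pi\<^sub>M I (\<lambda>_. \<nu>)). \<forall>j\<in>J. ndist d N (X i) (X j) \<le> \<rho>}" for J I
  have A_sets: "A J I \<in> sets (Pi\<^sub>M I (\<lambda>_. \<nu>))" if "finite J" "J \<subseteq> I" "i \<in> I" for J I
  proof -
    have "(\<lambda>X. ndist d N (X i) (X j)) \<in> borel_measurable (Pi\<^sub>M I (\<lambda>_. \<nu>))" if "j \<in> J" for j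
      using that \<open>J \<subseteq> I\<close> \<open>i \<in> I\<close>
      by (intro ndist_measurable_sample measurable_component_singleton) auto
    with \<open>finite J\<close> show ?thesis unfolding A_def
      by (intro sets.sets_Collect_finite_All borel_measurable_le) auto
  qed
  have ball_sets: "nball d N x \<rho> \<in> sets \<nu>" if "x \<in> Rd d" for x
  proof -
    have "(\<lambda>y. ndist d N x y) \<in> borel_measurable \<nu>"
      using that by (intro ndist_measurable_sample) (auto simp: space_sample)
    then have "{y \<in> space \<nu>. ndist d N x y \<le> \<rho>} \<in> sets \<nu>" by simp
    then show ?thesis by (simp add: nball_def space_sample)
  qed
  have "emeasure (Pi\<^sub>M I (\<lambda>_. \<nu>)) (A (insert j J) I)
    = (\<integral>\<^sup>+ X. indicator (A (insert j J) I) X \<partial>Pi\<^sub>M I (\<lambda>_. \<nu>))"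
    using insert.prems insert.hyps by (subst nn_integral_indicator) (auto intro!: A_sets)
  also have "\<dots> = (\<integral>\<^sup>+ X. (\<integral>\<^sup>+ y. indicator (A (insert j J) I) (X(j := y)) \<partial>\<nu>) \<partial>Pi\<^sub>M I' (\<lambda>_. \<nu>))"
    using insert.prems insert.hyps I(2,3) A_sets[of "insert j J" I] unfolding I(1)
    by (subst product_nn_integral_insert) auto
  \<comment> \<open>The conditions for \<open>J\<close> do not involve the coordinate
    \<open>j\<close>, and the condition for \<open>j\<close> places \<open>y\<close> in the ball
    around \<open>X i\<close>. The indicator is therefore bounded by a product, and the inner
    integral by \<open>p\<close>.\<close>
  also have "\<dots> \<le> (\<integral>\<^sup>+ X. p * indicator (A J I') X \<partial>Pi\<^sub>M I' (\<lambda>_. \<nu>))"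
  proof (rule nn_integral_mono)
    fix X assume X: "X \<in> space (Pi\<^sub>M I' (\<lambda>_. \<nu>))"
    then have Xi: "X i \<in> Rd d"
      using I by (auto simp: space_PiM PiE_iff space_sample)
    have "(\<integral>\<^sup>+ y. indicator (A (insert j J) I) (X(j := y)) \<partial>\<nu>)
      \<le> (\<integral>\<^sup>+ y. indicator (A J I') X * indicator (nball d N (X i) \<rho>) y \<partial>\<nu>)"
    proof (rule nn_integral_mono)
      fix y assume "y \<in> space \<nu>"
      have "X \<in> A J I'" "y \<in> nball d N (X i) \<rho>" if "X(j := y) \<in> A (insert j J) I"
      proof -
        have *: "\<forall>l\<in>insert j J. ndist d N ((X(j := y)) i) ((X(j := y)) l) \<le> \<rho>"
          using that by (simp add: A_def)
        have "ndist d N (X i) (X l) \<le> \<rho>" if "l \<in> J" for l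
          using *[rule_format, of l] that I insert.hyps by (auto split: if_splits)
        then show "X \<in> A J I'" using X by (simp add: A_def)
        show "y \<in> nball d N (X i) \<rho>"
          using *[rule_format, of j] I \<open>y \<in> space \<nu>\<close> by (auto simp: nball_def space_sample split: if_splits)
      qed
      then show "indicator (A (insert j J) I) (X(j := y))
        \<le> (indicator (A J I') X * indicator (nball d N (X i) \<rho>) y :: ennreal)"
        by (auto split: split_indicator)
    qed
    also have "\<dots> = indicator (A J I') X * emeasure \<nu> (nball d N (X i) \<rho>)"
      using ball_sets[OF Xi] by (rule nn_integral_cmult_indicator)
    also have "\<dots> \<le> indicator (A J I') X * p"
      by (intro mult_left_mono p Xi) simp
    finally show "(\<integral>\<^sup>+ y. indicator (A (insert j J) I) (X(j := y)) \<partial>\<nu>) \<le> p * indicator (A J I') X"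
      by (simp add: mult.commute)
  qed
  also have "\<dots> = p * emeasure (Pi\<^sub>M I' (\<lambda>_. \<nu>)) (A J I')"
    using insert.hyps I by (intro nn_integral_cmult_indicator A_sets) auto
  also have "\<dots> \<le> p * p ^ card J"
    using insert.IH[OF I(2,4,5)] by (intro mult_left_mono) (auto simp: A_def)
  finally show ?case
    using insert.hyps by (simp add: A_def)
qed

text \<open>For \<open>i < n\<close> these are the neighbours of \<open>i\<close> in the random
  geometric graph.\<close>

definition close_points :: "real \<Rightarrow> nat \<Rightarrow> (nat \<Rightarrow> nat \<Rightarrow> real) \<Rightarrow> nat \<Rightarrow> nat set" where
  "close_points \<rho> n X i = {j \<in> {..<n} - {i}. ndist d N (X i) (X j) \<le> \<rho>}"

text \<open>Union bound over the pairs of a centre \<open>i\<close> and a \<open>k\<close>-element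
  set \<open>J\<close> of other indices; there are at most \<open>n * n ^ k\<close> of them.\<close>

lemma emeasure_many_close_points_le:
  assumes p: "\<And>x. x \<in> Rd d \<Longrightarrow> emeasure \<nu> (nball d N x \<rho>) \<le> p"
  shows "emeasure (Pi\<^sub>M {..<n} (\<lambda>_. \<nu>))
      {X \<in> space (Pi\<^sub>M {..<n} (\<lambda>_. \<nu>)). \<exists>i<n. k \<le> card (close_points \<rho> n X i)}
    \<le> of_nat n * (of_nat n * p) ^ k" (is "emeasure ?M ?B \<le> _")
proof -
  define T where "T = Sigma {..<n} (\<lambda>i. nsets ({..<n} - {i}) k)"
  define A where "A = (\<lambda>(i, J). {X \<in> space ?M. \<forall>j\<in>J. ndist d N (X i) (X j) \<le> \<rho>})"
  have fin: "finite (nsets ({..<n} - {i}) k)" for i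
    by (simp add: finite_imp_finite_nsets)
  then have "finite T" by (simp add: T_def)
  have A_sets: "A z \<in> sets ?M" if "z \<in> T" for z
  proof -
    obtain i J where z: "z = (i, J)" by fastforce
    with that have iJ: "i < n" "J \<subseteq> {..<n}" by (auto simp: T_def nsets_def)
    have "(\<lambda>X. ndist d N (X i) (X j)) \<in> borel_measurable ?M" if "j \<in> J" for j
      using that iJ by (intro ndist_measurable_sample measurable_component_singleton) auto
    with finite_subset[OF iJ(2)] show ?thesis unfolding A_def z
      by (auto intro!: sets.sets_Collect_finite_All borel_measurable_le)
  qed
  have "?B \<subseteq> (\<Union>z\<in>T. A z)"
  proof
    fix X assume "X \<in> ?B"
    then obtain i where X: "X \<in> space ?M" and i: "i < n" "k \<le> card (close_points \<rho> n X i)" by auto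
    obtain J where "J \<subseteq> close_points \<rho> n X i" "card J = k"
      using obtain_subset_with_card_n[OF i(2)] by blast
    moreover have "finite J" if "J \<subseteq> close_points \<rho> n X i"
      using finite_subset[OF that] by (simp add: close_points_def)
    ultimately have "(i, J) \<in> T" "X \<in> A (i, J)"
      using i X by (auto simp: T_def A_def nsets_def close_points_def)
    then show "X \<in> (\<Union>z\<in>T. A z)" by blast
  qed
  then have "emeasure ?M ?B \<le> emeasure ?M (\<Union>z\<in>T. A z)"
    by (rule emeasure_mono) (use A_sets \<open>finite T\<close> in auto)
  also have "\<dots> \<le> (\<Sum>z\<in>T. emeasure ?M (A z))"
    using A_sets \<open>finite T\<close> by (intro emeasure_subadditive_finite) auto
  also have "\<dots> \<le> (\<Sum>z\<in>T. p ^ k)"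
  proof (rule sum_mono)
    fix z assume "z \<in> T"
    then obtain i J where z: "z = (i, J)" "i < n" "J \<subseteq> {..<n} - {i}" "finite J" "card J = k"
      by (auto simp: T_def nsets_def)
    show "emeasure ?M (A z) \<le> p ^ k"
      using emeasure_all_close_le[OF p z(4), of "{..<n}" i] z by (auto simp: A_def)
  qed
  also have "\<dots> = of_nat (card T) * p ^ k" by simp
  also have "\<dots> \<le> of_nat (n * n ^ k) * p ^ k"
  proof (intro mult_right_mono of_nat_mono)
    have "card T = (\<Sum>i<n. (n - 1) choose k)"
      unfolding T_def using fin by (subst card_SigmaI) (auto intro!: sum.cong simp: card_nsets)
    also have "\<dots> \<le> n * n ^ k"
    proof -
      have "(n - 1) choose k \<le> (n - 1) ^ k"
        by (cases "k \<le> n - 1") (auto intro: binomial_le_pow simp: binomial_eq_0)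
      also have "\<dots> \<le> n ^ k" by (intro power_mono) auto
      finally show ?thesis by simp
    qed
    finally show "card T \<le> n * n ^ k" .
  qed simp
  finally show ?thesis by (simp add: power_mult_distrib mult_ac)
qed

end

subsection \<open>Cliques of the perturbed graph\<close>

text \<open>
  A pair \<open>e\<close> is counted through the four elements of \<open>e \<times> e\<close>, which is cruder than the two
  orientations; hence \<open>4 * t\<close> instead of \<open>2 * t\<close>.
\<close>

lemma card_nonedges_ge:
  assumes "finite S" and deg: "\<And>i. i \<in> S \<Longrightarrow> card {j \<in> S - {i}. {i, j} \<in> R} \<le> k"
    and card: "card S = 4 * t + 1 + k"
  shows "card S * t \<le> card (nsets S 2 - R)"
proof -
  define F where "F = nsets S 2 - R"
  define D where "D = Sigma S (\<lambda>i. {j \<in> S - {i}. {i, j} \<notin> R})"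
  have "finite F" using assms(1) by (simp add: F_def finite_imp_finite_nsets)
  have e: "finite e" "card e = 2" if "e \<in> F" for e
    using that by (auto simp: F_def nsets_def)
  have "card S * (4 * t) = (\<Sum>i\<in>S. 4 * t)" by simp
  also have "\<dots> \<le> (\<Sum>i\<in>S. card {j \<in> S - {i}. {i, j} \<notin> R})"
  proof (rule sum_mono)
    fix i assume i: "i \<in> S"
    have "card (S - {i}) = card ({j \<in> S - {i}. {i, j} \<in> R} \<union> {j \<in> S - {i}. {i, j} \<notin> R})"
      by (rule arg_cong[where f = card]) blast
    also have "\<dots> \<le> card {j \<in> S - {i}. {i, j} \<in> R} + card {j \<in> S - {i}. {i, j} \<notin> R}"
      by (rule card_Un_le)
    finally show "4 * t \<le> card {j \<in> S - {i}. {i, j} \<notin> R}"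
      using deg[OF i] card i assms(1) by simp
  qed
  also have "\<dots> = card D"
    unfolding D_def using assms(1) by (subst card_SigmaI) auto
  also have "card D \<le> card (\<Union>e\<in>F. e \<times> e)"
  proof (rule card_mono)
    show "finite (\<Union>e\<in>F. e \<times> e)" using \<open>finite F\<close> e by auto
    show "D \<subseteq> (\<Union>e\<in>F. e \<times> e)"
    proof
      fix z assume "z \<in> D"
      then obtain i j where "z = (i, j)" "i \<in> S" "j \<in> S" "i \<noteq> j" "{i, j} \<notin> R" by (auto simp: D_def)
      then have "{i, j} \<in> F" "z \<in> {i, j} \<times> {i, j}" by (auto simp: F_def doubleton_in_nsets_2)
      then show "z \<in> (\<Union>e\<in>F. e \<times> e)" by blast
    qed
  qed
  also have "\<dots> \<le> (\<Sum>e\<in>F. card (e \<times> e))"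
    by (rule card_UN_le) fact
  also have "\<dots> = 4 * card F"
    using e by (simp add: card_cartesian_product)
  finally show ?thesis by (simp add: F_def)
qed

text \<open>\<open>Max\<close> obeys the bound only on a finite nonempty set: \<open>m\<close>
  bounds the sizes, and the edge \<open>{u, v}\<close> is itself a clique of the required
  kind.\<close>

lemma edge_clique_number_le:
  assumes "finite V" "{u, v} \<in> E" "u \<in> V" "v \<in> V"
    and "\<And>S. S \<subseteq> V \<Longrightarrow> clique S E \<Longrightarrow> card S \<le> m"
  shows "edge_clique_number V E u v \<le> m"
  unfolding edge_clique_number_def
proof (rule Max.boundedI)
  have "{card S |S. S \<subseteq> V \<and> clique S E \<and> u \<in> S \<and> v \<in> S} \<subseteq> {..m}"
    using assms(5) by blast
  then show "finite {card S |S. S \<subseteq> V \<and> clique S E \<and> u \<in> S \<and> v \<in> S}"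
    by (rule finite_subset) simp
  have "clique {u, v} E" using assms(2) by (auto simp: clique_def insert_commute)
  then have "card {u, v} \<in> {card S |S. S \<subseteq> V \<and> clique S E \<and> u \<in> S \<and> v \<in> S}"
    using assms(3,4) by (intro CollectI exI[of _ "{u, v}"]) simp
  then show "{card S |S. S \<subseteq> V \<and> clique S E \<and> u \<in> S \<and> v \<in> S} \<noteq> {}"
    by (rule ex_in_conv[THEN iffD1, OF exI])
qed (use assms(5) in blast)

lemma emeasure_all_coins:
  assumes "finite F" "F \<subseteq> I" "0 \<le> p" "p \<le> 1"
  shows "emeasure (Pi\<^sub>M I (\<lambda>_. measure_pmf (bernoulli_pmf p)))
      {W \<in> space (Pi\<^sub>M I (\<lambda>_. measure_pmf (bernoulli_pmf p))). \<forall>e\<in>F. W e} = ennreal (p ^ card F)"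
proof -
  interpret product_prob_space "\<lambda>_. measure_pmf (bernoulli_pmf p)" I
    by unfold_locales
  have "emeasure (measure_pmf (bernoulli_pmf p)) {True} = ennreal p"
    using assms by (simp add: emeasure_pmf_single)
  then show ?thesis
    using emeasure_PiM_Collect[of F "\<lambda>_. {True}"] assms by (simp add: ennreal_power)
qed

section \<open>Measurability of the events of the perturbed graph\<close>

context sampling
begin

lemma measurable_sample_point:
  assumes "i < n"
  shows "(\<lambda>\<omega>. fst \<omega> i) \<in> measurable (noisy_space \<nu> p n) \<nu>"
  unfolding noisy_space_def using assms
  by (intro measurable_compose[OF measurable_fst measurable_component_singleton]) simp

text \<open>For distinct \<open>i\<close>, \<open>j\<close> below \<open>n\<close> the event
  combines a distance comparison with one coin. For all other indices it is empty.\<close>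

lemma pred_doubleton_in_noisy_edges:
  "Measurable.pred (noisy_space \<nu> p n) (\<lambda>\<omega>. {i, j} \<in> noisy_edges d N \<rho> n \<omega>)"
proof (cases "i < n \<and> j < n \<and> i \<noteq> j")
  case True
  have "(\<lambda>\<omega>. ndist d N (fst \<omega> i) (fst \<omega> j)) \<in> borel_measurable (noisy_space \<nu> p n)"
    using True by (intro ndist_measurable_sample measurable_sample_point) auto
  then have "Measurable.pred (noisy_space \<nu> p n) (\<lambda>\<omega>. ndist d N (fst \<omega> i) (fst \<omega> j) \<le> \<rho>)"
    by measurable
  moreover have "(\<lambda>\<omega>. snd \<omega> {i, j}) \<in> measurable (noisy_space \<nu> p n) (measure_pmf (bernoulli_pmf p))"
    unfolding noisy_space_def using True
    by (intro measurable_compose[OF measurable_snd measurable_component_singleton])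
       (simp add: doubleton_in_nsets_2)
  then have "Measurable.pred (noisy_space \<nu> p n) (\<lambda>\<omega>. snd \<omega> {i, j})"
    by (simp cong: measurable_cong_sets)
  ultimately show ?thesis
    using True by (simp add: doubleton_in_noisy_edges[OF is_norm])
qed (simp add: doubleton_in_noisy_edges[OF is_norm] cong: conj_cong)

lemma pred_clique_noisy_edges:
  "finite S \<Longrightarrow> Measurable.pred (noisy_space \<nu> p n) (\<lambda>\<omega>. clique S (noisy_edges d N \<rho> n \<omega>))"
  unfolding clique_def
  by (intro pred_intros_finite pred_intros_logic pred_doubleton_in_noisy_edges) simp_all

text \<open>Both edge sets consist of pairs from \<open>{..<n}\<close>, so their equality is a
  finite Boolean combination of single-edge events.\<close>

lemma pred_noisy_edges_eq:
  assumes "E \<subseteq> nsets {..<n} 2"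
  shows "Measurable.pred (noisy_space \<nu> p n) (\<lambda>\<omega>. noisy_edges d N \<rho> n \<omega> = E)"
proof -
  have "noisy_edges d N \<rho> n \<omega> = E \<longleftrightarrow>
      (\<forall>i\<in>{..<n}. \<forall>j\<in>{..<n}. {i, j} \<in> noisy_edges d N \<rho> n \<omega> \<longleftrightarrow> {i, j} \<in> E)" for \<omega>
    using assms noisy_edges_subset[of d N \<rho> n \<omega>] by (blast elim!: nsets2_E)
  then show ?thesis
    by (simp only:) (intro pred_intros_finite pred_intros_logic pred_doubleton_in_noisy_edges; simp)
qed

text \<open>
  Measurability matters: the probability of a non-measurable event would be the junk value \<open>0\<close>.
  The event is split according to the finitely many values of the edge set.
\<close>

lemma pred_long_edges_clique_bound:
  "Measurable.pred (noisy_space \<nu> p n)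
    (\<lambda>\<omega>. \<forall>u v. long_edge d N \<rho> n \<omega> u v \<longrightarrow>
        real (edge_clique_number {..<n} (noisy_edges d N \<rho> n \<omega>) u v) \<le> b)"
proof -
  \<comment> \<open>Once the edge set is fixed as \<open>E\<close>, the edge clique number is a
    constant. Endpoints of edges lie in \<open>{..<n}\<close>, which makes the quantifiers over
    \<open>u\<close> and \<open>v\<close> finite.\<close>
  have *: "(\<forall>u v. long_edge d N \<rho> n \<omega> u v \<longrightarrow>
        real (edge_clique_number {..<n} (noisy_edges d N \<rho> n \<omega>) u v) \<le> b) \<longleftrightarrow>
      (\<forall>E\<in>Pow (nsets {..<n} 2). noisy_edges d N \<rho> n \<omega> = E \<longrightarrow>
        (\<forall>u\<in>{..<n}. \<forall>v\<in>{..<n}. ndist d N (fst \<omega> u) (fst \<omega> v) > 3 * \<rho> \<longrightarrow>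
          {u, v} \<in> E \<longrightarrow> real (edge_clique_number {..<n} E u v) \<le> b))" for \<omega>
    using noisy_edges_subset[of d N \<rho> n \<omega>] doubleton_in_noisy_edges[OF is_norm, of _ _ \<rho> n \<omega>]
    unfolding long_edge_def by blast
  have "(\<lambda>\<omega>. ndist d N (fst \<omega> i) (fst \<omega> j)) \<in> borel_measurable (noisy_space \<nu> p n)"
    if "i \<in> {..<n}" "j \<in> {..<n}" for i j
    using that by (intro ndist_measurable_sample measurable_sample_point) auto
  then show ?thesis
    unfolding *
    by (intro pred_intros_finite pred_intros_logic pred_noisy_edges_eq borel_measurable_pred_less
        borel_measurable_const) (auto simp: finite_imp_finite_nsets)
qed

section \<open>Probability bounds for large degrees and large cliques\<close>

lemma prob_space_noisy_space: "prob_space (noisy_space \<nu> p n)"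
proof -
  interpret M1: prob_space "Pi\<^sub>M {..<n} (\<lambda>_. \<nu>)"
    by (rule prob_space_PiM) (rule prob_space_sample)
  interpret M2: prob_space "Pi\<^sub>M (nsets {..<n} 2) (\<lambda>_. measure_pmf (bernoulli_pmf p))"
    by (rule prob_space_PiM) (rule prob_space_measure_pmf)
  interpret pair_prob_space "Pi\<^sub>M {..<n} (\<lambda>_. \<nu>)" "Pi\<^sub>M (nsets {..<n} 2) (\<lambda>_. measure_pmf (bernoulli_pmf p))" ..
  show ?thesis unfolding noisy_space_def by (rule P.prob_space_axioms)
qed

text \<open>The good event for the sample: all degrees of the random geometric graph are below
  \<open>k\<close>. It does not depend on the coins, so one can condition on it.\<close>

definition sparse :: "real \<Rightarrow> nat \<Rightarrow> nat \<Rightarrow> (nat \<Rightarrow> nat \<Rightarrow> real) \<Rightarrow> bool" where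
  "sparse \<rho> n k X \<longleftrightarrow> (\<forall>i<n. card (close_points \<rho> n X i) < k)"

text \<open>The cardinality of a random set is avoided by saying that no fixed \<open>J\<close> with
  at least \<open>k\<close> elements consists of close points. This is a finite combination of
  distance comparisons.\<close>

lemma pred_sparse: "Measurable.pred (Pi\<^sub>M {..<n} (\<lambda>_. \<nu>)) (sparse \<rho> n k)"
proof -
  have *: "sparse \<rho> n k X \<longleftrightarrow> (\<forall>i\<in>{..<n}. \<forall>J\<in>Pow ({..<n} - {i}). k \<le> card J \<longrightarrow>
      \<not> (\<forall>j\<in>J. ndist d N (X i) (X j) \<le> \<rho>))" for X
  proof (intro iffI ballI impI notI)
    fix i J assume "sparse \<rho> n k X" "i \<in> {..<n}" "J \<in> Pow ({..<n} - {i})" "k \<le> card J"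
      "\<forall>j\<in>J. ndist d N (X i) (X j) \<le> \<rho>"
    moreover from this have "card J \<le> card (close_points \<rho> n X i)"
      by (intro card_mono) (auto simp: close_points_def)
    ultimately show False by (force simp: sparse_def)
  next
    assume "\<forall>i\<in>{..<n}. \<forall>J\<in>Pow ({..<n} - {i}). k \<le> card J \<longrightarrow>
      \<not> (\<forall>j\<in>J. ndist d N (X i) (X j) \<le> \<rho>)"
    moreover have "close_points \<rho> n X i \<in> Pow ({..<n} - {i})" for i
      by (auto simp: close_points_def)
    moreover have "\<forall>j\<in>close_points \<rho> n X i. ndist d N (X i) (X j) \<le> \<rho>" for i
      by (simp add: close_points_def)
    ultimately show "sparse \<rho> n k X"
      unfolding sparse_def by (meson lessThan_iff not_le)
  qed
  have "(\<lambda>X. ndist d N (X i) (X j)) \<in> borel_measurable (Pi\<^sub>M {..<n} (\<lambda>_. \<nu>))"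
    if "i \<in> {..<n}" "j \<in> {..<n}" for i j
    using that by (intro ndist_measurable_sample measurable_component_singleton) auto
  then show ?thesis
    unfolding *
    by (intro pred_intros_finite pred_intros_logic borel_measurable_pred_less borel_measurable_const)
      (auto intro: finite_subset)
qed

text \<open>Fix the sample and integrate over the coins. For a sparse sample, \<open>S\<close>
  contains at least \<open>card S * t\<close> non-edges of the geometric graph, and a clique on
  \<open>S\<close> needs a successful independent coin for each; for any other sample the section is
  empty.\<close>

lemma emeasure_clique_le:
  assumes S: "S \<subseteq> {..<n}" "card S = 4 * t + 1 + k" and p: "0 \<le> p" "p \<le> 1"
  shows "emeasure (noisy_space \<nu> p n) {\<omega> \<in> space (noisy_space \<nu> p n).
      sparse \<rho> n k (fst \<omega>) \<and> clique S (noisy_edges d N \<rho> n \<omega>)} \<le> ennreal (p ^ (card S * t))"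
    (is "emeasure _ ?A \<le> _")
proof -
  define M1 where "M1 = Pi\<^sub>M {..<n} (\<lambda>_. \<nu>)"
  define M2 where "M2 = Pi\<^sub>M (nsets {..<n} 2) (\<lambda>_. measure_pmf (bernoulli_pmf p))"
  have M: "noisy_space \<nu> p n = M1 \<Otimes>\<^sub>M M2"
    by (simp add: noisy_space_def M1_def M2_def)
  interpret M1: prob_space M1
    unfolding M1_def by (rule prob_space_PiM) (rule prob_space_sample)
  interpret M2: prob_space M2
    unfolding M2_def by (rule prob_space_PiM) (rule prob_space_measure_pmf)
  have "finite S" using S(1) by (rule finite_subset) simp
  have "Measurable.pred (noisy_space \<nu> p n) (\<lambda>\<omega>. sparse \<rho> n k (fst \<omega>))"
    unfolding M M1_def by (rule measurable_compose[OF measurable_fst pred_sparse])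
  then have A: "?A \<in> sets (M1 \<Otimes>\<^sub>M M2)"
    using pred_clique_noisy_edges[OF \<open>finite S\<close>, of \<rho> n p] unfolding M[symmetric]
    by (intro sets.sets_Collect_conj predE)
  have "emeasure M2 (Pair X -` ?A) \<le> ennreal (p ^ (card S * t))" for X
  proof (cases "sparse \<rho> n k X")
    case True
    define F where "F = nsets S 2 - rgg_edges d N \<rho> n X"
    have "finite F" "F \<subseteq> nsets {..<n} 2"
      using nsets_mono[OF S(1), of 2] \<open>finite S\<close> by (auto simp: F_def finite_imp_finite_nsets)
    have ge: "card S * t \<le> card F" unfolding F_def
    proof (rule card_nonedges_ge[OF \<open>finite S\<close> _ S(2)])
      fix i assume "i \<in> S"
      have "card {j \<in> S - {i}. {i, j} \<in> rgg_edges d N \<rho> n X} \<le> card (close_points \<rho> n X i)"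
        by (intro card_mono) (auto simp: close_points_def doubleton_in_rgg_edges[OF is_norm])
      also have "\<dots> \<le> k" using True \<open>i \<in> S\<close> S(1) by (force simp: sparse_def)
      finally show "card {j \<in> S - {i}. {i, j} \<in> rgg_edges d N \<rho> n X} \<le> k" .
    qed
    have sets_F: "{W \<in> space M2. \<forall>e\<in>F. W e} \<in> sets M2"
    proof -
      have "Measurable.pred M2 (\<lambda>W. W e)" if "e \<in> F" for e
      proof -
        have "(\<lambda>W. W e) \<in> measurable M2 (measure_pmf (bernoulli_pmf p))"
          unfolding M2_def using that \<open>F \<subseteq> nsets {..<n} 2\<close>
          by (intro measurable_component_singleton) blast
        then show ?thesis by (simp cong: measurable_cong_sets)
      qed
      with \<open>finite F\<close> have "Measurable.pred M2 (\<lambda>W. \<forall>e\<in>F. W e)"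
        by (intro pred_intros_finite)
      then show ?thesis by measurable
    qed
    have sub: "Pair X -` ?A \<subseteq> {W \<in> space M2. \<forall>e\<in>F. W e}"
    proof safe
      fix W assume W: "(X, W) \<in> space (noisy_space \<nu> p n)" "clique S (noisy_edges d N \<rho> n (X, W))"
      then show "W \<in> space M2" by (simp add: M space_pair_measure)
      fix e assume "e \<in> F"
      then obtain i j where "e = {i, j}" "i \<in> S" "j \<in> S" "i \<noteq> j" "{i, j} \<notin> rgg_edges d N \<rho> n X"
        by (auto simp: F_def elim!: nsets2_E)
      with W(2) show "W e" by (auto simp: clique_def noisy_edges_def)
    qed
    have "emeasure M2 (Pair X -` ?A) \<le> emeasure M2 {W \<in> space M2. \<forall>e\<in>F. W e}"
      by (rule emeasure_mono[OF sub sets_F])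
    also have "\<dots> = ennreal (p ^ card F)"
      unfolding M2_def using emeasure_all_coins[OF \<open>finite F\<close> \<open>F \<subseteq> nsets {..<n} 2\<close> p] .
    also have "\<dots> \<le> ennreal (p ^ (card S * t))"
      using p ge by (intro ennreal_leI power_decreasing)
    finally show ?thesis .
  next
    case False
    then have "Pair X -` ?A = {}" by auto
    then show ?thesis by (simp only: emeasure_empty zero_le)
  qed
  then have "(\<integral>\<^sup>+ X. emeasure M2 (Pair X -` ?A) \<partial>M1) \<le> (\<integral>\<^sup>+ X. ennreal (p ^ (card S * t)) \<partial>M1)"
    by (intro nn_integral_mono)
  then show ?thesis
    using M2.emeasure_pair_measure_alt[OF A] by (simp add: M M1.emeasure_space_1)
qed

text \<open>The event is a rectangle with the whole coin space as second factor, so its probability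
  is that of a large degree in the sample.\<close>

lemma emeasure_not_sparse_le:
  assumes "\<And>x. x \<in> Rd d \<Longrightarrow> emeasure \<nu> (nball d N x \<rho>) \<le> a"
  shows "emeasure (noisy_space \<nu> p n) {\<omega> \<in> space (noisy_space \<nu> p n). \<not> sparse \<rho> n k (fst \<omega>)}
    \<le> of_nat n * (of_nat n * a) ^ k"
proof -
  define M1 where "M1 = Pi\<^sub>M {..<n} (\<lambda>_. \<nu>)"
  define M2 where "M2 = Pi\<^sub>M (nsets {..<n} 2) (\<lambda>_. measure_pmf (bernoulli_pmf p))"
  have M: "noisy_space \<nu> p n = M1 \<Otimes>\<^sub>M M2"
    by (simp add: noisy_space_def M1_def M2_def)
  interpret M2: prob_space M2
    unfolding M2_def by (rule prob_space_PiM) (rule prob_space_measure_pmf)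
  let ?B = "{X \<in> space M1. \<not> sparse \<rho> n k X}"
  have "?B \<in> sets M1"
    unfolding M1_def by (intro sets.sets_Collect_neg predE pred_sparse)
  then have "emeasure (M1 \<Otimes>\<^sub>M M2) (?B \<times> space M2) = emeasure M1 ?B"
    by (subst M2.emeasure_pair_measure_Times) (simp_all add: M2.emeasure_space_1)
  moreover have "{\<omega> \<in> space (M1 \<Otimes>\<^sub>M M2). \<not> sparse \<rho> n k (fst \<omega>)} = ?B \<times> space M2"
    by (auto simp: space_pair_measure)
  moreover have "emeasure M1 ?B \<le> of_nat n * (of_nat n * a) ^ k"
    unfolding M1_def using emeasure_many_close_points_le[OF assms, of n k]
    by (simp add: sparse_def not_less)
  ultimately show ?thesis by (simp add: M)
qed

text \<open>Failure requires a non-sparse sample, which costs the first summand, or a clique on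
  \<open>s = 4 * t + 1 + k\<close> vertices in a sparse one. A union bound over the at most
  \<open>n ^ s\<close> vertex sets gives the second summand.\<close>

lemma prob_long_edges_clique_bound:
  assumes ball: "\<And>x. x \<in> Rd d \<Longrightarrow> emeasure \<nu> (nball d N x \<rho>) \<le> ennreal a" and "0 \<le> a"
    and p: "0 \<le> p" "p \<le> 1" and n: "0 < n" and t: "real n ^ 2 * p ^ t \<le> 1"
    and b: "real (4 * t + 1 + k) \<le> b"
  shows "\<P>(\<omega> in noisy_space \<nu> p n. \<forall>u v. long_edge d N \<rho> n \<omega> u v \<longrightarrow>
        real (edge_clique_number {..<n} (noisy_edges d N \<rho> n \<omega>) u v) \<le> b)
      \<ge> 1 - (real n * (real n * a) ^ k + 1 / real n)"
proof -
  interpret prob_space "noisy_space \<nu> p n" by (rule prob_space_noisy_space)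
  let ?M = "noisy_space \<nu> p n"
  define G where "G = {\<omega> \<in> space ?M. \<forall>u v. long_edge d N \<rho> n \<omega> u v \<longrightarrow>
        real (edge_clique_number {..<n} (noisy_edges d N \<rho> n \<omega>) u v) \<le> b}"
  define s where "s = 4 * t + 1 + k"
  define B where "B = {\<omega> \<in> space ?M. \<not> sparse \<rho> n k (fst \<omega>)}"
  define A where "A S = {\<omega> \<in> space ?M. sparse \<rho> n k (fst \<omega>) \<and> clique S (noisy_edges d N \<rho> n \<omega>)}" for S
  define T where "T = nsets {..<n} s"
  have "finite T" by (simp add: T_def finite_imp_finite_nsets)
  have G: "G \<in> events"
    unfolding G_def by (intro predE pred_long_edges_clique_bound)
  have sparse: "Measurable.pred ?M (\<lambda>\<omega>. sparse \<rho> n k (fst \<omega>))"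
    unfolding noisy_space_def by (rule measurable_compose[OF measurable_fst pred_sparse])
  then have B: "B \<in> events"
    unfolding B_def by (intro sets.sets_Collect_neg predE)
  have A: "A S \<in> events" if "S \<in> T" for S
    using that unfolding A_def T_def nsets_def
    by (intro sets.sets_Collect_conj predE sparse pred_clique_noisy_edges) auto
  have "space ?M - G \<subseteq> B \<union> (\<Union>S\<in>T. A S)"
  proof
    fix \<omega> assume \<omega>: "\<omega> \<in> space ?M - G"
    then obtain u v where long: "long_edge d N \<rho> n \<omega> u v"
      and "\<not> real (edge_clique_number {..<n} (noisy_edges d N \<rho> n \<omega>) u v) \<le> b"
      by (auto simp: G_def)
    then have "\<not> edge_clique_number {..<n} (noisy_edges d N \<rho> n \<omega>) u v \<le> s"
      using b unfolding s_def by linarith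
    moreover have "{u, v} \<in> noisy_edges d N \<rho> n \<omega>" using long by (simp add: long_edge_def)
    moreover from this have "u < n" "v < n" by (simp_all add: doubleton_in_noisy_edges[OF is_norm])
    ultimately obtain S where S: "S \<subseteq> {..<n}" "clique S (noisy_edges d N \<rho> n \<omega>)" "s \<le> card S"
      using edge_clique_number_le[of "{..<n}" u v "noisy_edges d N \<rho> n \<omega>" s]
      by (metis finite_lessThan lessThan_iff nat_le_linear)
    \<comment> \<open>Cutting the clique down to exactly \<open>s\<close> vertices leaves a clique
      of the size handled by the bound for a single set.\<close>
    obtain S' where "S' \<subseteq> S" "card S' = s" "finite S'"
      using obtain_subset_with_card_n[OF S(3)] by blast
    with S have "S' \<in> T" "clique S' (noisy_edges d N \<rho> n \<omega>)"
      by (auto simp: T_def nsets_def intro: smaller_clique)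
    with \<omega> show "\<omega> \<in> B \<union> (\<Union>S\<in>T. A S)"
      by (auto simp: A_def B_def)
  qed
  then have "emeasure ?M (space ?M - G) \<le> emeasure ?M (B \<union> (\<Union>S\<in>T. A S))"
    by (rule emeasure_mono) (use A B \<open>finite T\<close> in auto)
  also have "\<dots> \<le> emeasure ?M B + emeasure ?M (\<Union>S\<in>T. A S)"
    using A B \<open>finite T\<close> by (intro emeasure_subadditive) auto
  also have "\<dots> \<le> ennreal (real n * (real n * a) ^ k) + ennreal (1 / real n)"
  proof (rule add_mono)
    have "emeasure ?M B \<le> of_nat n * (of_nat n * ennreal a) ^ k"
      unfolding B_def by (rule emeasure_not_sparse_le[OF ball])
    also have "\<dots> = ennreal (real n * (real n * a) ^ k)"
      using \<open>0 \<le> a\<close> by (simp add: ennreal_of_nat_eq_real_of_nat ennreal_mult flip: ennreal_power)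
    finally show "emeasure ?M B \<le> ennreal (real n * (real n * a) ^ k)" .
    have "emeasure ?M (\<Union>S\<in>T. A S) \<le> (\<Sum>S\<in>T. emeasure ?M (A S))"
      using A \<open>finite T\<close> by (intro emeasure_subadditive_finite) auto
    also have "\<dots> \<le> (\<Sum>S\<in>T. ennreal (p ^ (s * t)))"
    proof (rule sum_mono)
      fix S assume "S \<in> T"
      then have "S \<subseteq> {..<n}" "card S = 4 * t + 1 + k" by (auto simp: T_def nsets_def s_def)
      from emeasure_clique_le[OF this p] this
      show "emeasure ?M (A S) \<le> ennreal (p ^ (s * t))" by (simp add: A_def s_def)
    qed
    also have "\<dots> = ennreal (real (card T) * p ^ (s * t))"
      using p by (simp add: ennreal_mult ennreal_of_nat_eq_real_of_nat)
    also have "\<dots> \<le> ennreal (1 / real n)"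
    proof (rule ennreal_leI)
      have "card T \<le> n ^ s"
        unfolding T_def card_nsets card_lessThan
        by (cases "s \<le> n") (auto intro: binomial_le_pow simp: binomial_eq_0)
      then have "real (card T) \<le> real n ^ s"
        by (metis of_nat_le_iff of_nat_power)
      then have "real (card T) * p ^ (s * t) \<le> real n ^ s * p ^ (s * t)"
        using p by (intro mult_right_mono) auto
      also have "\<dots> = (real n * p ^ t) ^ s"
        by (simp add: power_mult_distrib mult.commute flip: power_mult)
      \<comment> \<open>The square in \<open>real n ^ 2 * p ^ t \<le> 1\<close> is spent here: one
        factor pays for the choice of a vertex, the other leaves \<open>1 / real n\<close>.\<close>
      also have "\<dots> \<le> (1 / real n) ^ s"
        using t n p by (intro power_mono) (auto simp: field_simps power2_eq_square)
      also have "\<dots> \<le> (1 / real n) ^ 1"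
        using n by (intro power_decreasing) (auto simp: s_def)
      finally show "real (card T) * p ^ (s * t) \<le> 1 / real n" by simp
    qed
    finally show "emeasure ?M (\<Union>S\<in>T. A S) \<le> ennreal (1 / real n)" .
  qed
  also have "\<dots> = ennreal (real n * (real n * a) ^ k + 1 / real n)"
    using \<open>0 \<le> a\<close> by (intro ennreal_plus[symmetric]) auto
  finally have "prob (space ?M - G) \<le> real n * (real n * a) ^ k + 1 / real n"
    using \<open>0 \<le> a\<close> unfolding emeasure_eq_measure by (subst (asm) ennreal_le_iff) auto
  then show ?thesis
    using prob_compl[OF G] by (simp add: G_def)
qed

end

section \<open>Limits and the choice of constants\<close>

lemma standard_setting_imp_sampling:
  assumes "standard_setting d N \<nu> r"
  shows "sampling d N \<nu>"
  using assms unfolding standard_setting_def has_bounded_density_def sampling_def by auto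

text \<open>The failure probability is at most \<open>(c ^ k + 1) / real n\<close> for large
  \<open>n\<close>, so the success probability is squeezed to 1. Letting \<open>t\<close> and
  \<open>b\<close> depend on \<open>n\<close> covers both a constant and a logarithmic
  bound.\<close>

lemma with_high_probability_clique_bound:
  fixes \<alpha> :: real and t :: "nat \<Rightarrow> nat" and b :: "nat \<Rightarrow> real"
  assumes set: "standard_setting d N \<nu> r" and "0 < \<alpha>" and k: "2 \<le> \<alpha> * real k"
    and q: "\<And>n. 0 \<le> q n \<and> q n \<le> 1"
    and r: "\<forall>\<^sub>F n in sequentially. real n * r n ^ d \<le> real n powr (- \<alpha>)"
    and t: "\<forall>\<^sub>F n in sequentially. real n ^ 2 * q n ^ t n \<le> 1 \<and> real (4 * t n + 1 + k) \<le> b n"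
  shows "with_high_probability (\<lambda>n. noisy_space \<nu> (q n) n)
    (\<lambda>n \<omega>. \<forall>u v. long_edge d N (r n) n \<omega> u v \<longrightarrow>
      real (edge_clique_number {..<n} (noisy_edges d N (r n) n \<omega>) u v) \<le> b n)"
proof -
  interpret sampling d N \<nu> by (rule standard_setting_imp_sampling[OF set])
  have r_pos: "0 < r n" for n using set by (simp add: standard_setting_def)
  obtain c where c: "c > 0"
    "\<And>x \<rho>. x \<in> Rd d \<Longrightarrow> \<rho> > 0 \<Longrightarrow> emeasure \<nu> (nball d N x \<rho>) \<le> ennreal (c * \<rho> ^ d)"
    using bounded_density_ball_le[OF is_norm] set unfolding standard_setting_def by metis
  let ?P = "\<lambda>n. \<P>(\<omega> in noisy_space \<nu> (q n) n. \<forall>u v. long_edge d N (r n) n \<omega> u v \<longrightarrow>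
      real (edge_clique_number {..<n} (noisy_edges d N (r n) n \<omega>) u v) \<le> b n)"
  have ev: "\<forall>\<^sub>F n in sequentially. 1 - (c ^ k + 1) / real n \<le> ?P n"
    using r t eventually_gt_at_top[of 0]
  proof eventually_elim
    case (elim n)
    then have n: "real n \<ge> 1" by simp
    have "(real n * (c * r n ^ d)) ^ k \<le> (c * real n powr (- \<alpha>)) ^ k"
      using mult_left_mono[OF elim(1), of c] c(1) less_imp_le[OF r_pos]
      by (intro power_mono) (auto simp: mult_ac)
    also have "\<dots> = c ^ k * real n powr (- (\<alpha> * real k))"
      using n by (simp add: power_mult_distrib powr_power mult_ac)
    \<comment> \<open>The choice of \<open>k\<close> gives decay of order two; the union over the
      \<open>n\<close> centres uses up one order.\<close>
    also have "\<dots> \<le> c ^ k * real n powr (- 2)"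
      using c(1) n k by (intro mult_left_mono powr_mono) auto
    also have "\<dots> = c ^ k / real n ^ 2"
      using n by (simp add: powr_minus powr_numeral divide_inverse)
    finally have "real n * (real n * (c * r n ^ d)) ^ k \<le> real n * (c ^ k / real n ^ 2)"
      by (intro mult_left_mono) auto
    also have "\<dots> = c ^ k / real n" using n by (simp add: power2_eq_square)
    finally have "1 - (c ^ k + 1) / real n \<le> 1 - (real n * (real n * (c * r n ^ d)) ^ k + 1 / real n)"
      by (simp add: add_divide_distrib)
    also have "\<dots> \<le> ?P n"
      using elim q[of n] c(1) r_pos[of n]
      by (intro prob_long_edges_clique_bound[where t = "t n"] c(2)) auto
    finally show ?case .
  qed
  have "(\<lambda>n. 1 - (c ^ k + 1) / real n) \<longlonglongrightarrow> 1 - 0"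
    by (intro tendsto_diff tendsto_const lim_const_over_n)
  moreover have "\<forall>\<^sub>F n in sequentially. ?P n \<le> 1"
    by (intro always_eventually allI prob_space.prob_le_1 prob_space_noisy_space)
  ultimately show ?thesis
    unfolding with_high_probability_def
    by (intro tendsto_sandwich[OF ev _ _ tendsto_const]) simp_all
qed

theorem theorem3p5:
  fixes \<beta> :: nat and \<alpha> :: real
  assumes "0 < \<alpha>" and "\<alpha> \<le> 1 / (real \<beta>)\<^sup>2"
  shows
    "(\<exists>C1>0. \<exists>C2>0. \<forall>d N \<nu> (r :: nat \<Rightarrow> real) (q :: nat \<Rightarrow> real).
        standard_setting d N \<nu> r \<and> besicovitch_constant d N \<beta> \<and> (\<forall>n. 0 \<le> q n \<and> q n \<le> 1) \<and>
        (\<forall>\<^sub>F n in sequentially. real n * r n ^ d \<le> real n powr (- \<alpha>)) \<and>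
        (\<forall>\<^sub>F n in sequentially. q n \<le> C1 * (1 / real n) powr C2) \<longrightarrow>
        (\<exists>K :: real. with_high_probability (\<lambda>n. noisy_space \<nu> (q n) n)
           (\<lambda>n \<omega>. \<forall>u v. long_edge d N (r n) n \<omega> u v \<longrightarrow>
              real (edge_clique_number {..<n} (noisy_edges d N (r n) n \<omega>) u v) \<le> K)))
     \<and>
     (\<exists>\<xi>>0. \<forall>d N \<nu> (r :: nat \<Rightarrow> real) (q :: nat \<Rightarrow> real).
        standard_setting d N \<nu> r \<and> besicovitch_constant d N \<beta> \<and> (\<forall>n. 0 \<le> q n \<and> q n \<le> 1) \<and>
        (\<forall>\<^sub>F n in sequentially. real n * r n ^ d \<le> real n powr (- \<alpha>)) \<and>
        (\<forall>\<^sub>F n in sequentially. (1 / real n) powr \<xi> \<le> q n \<and> q n < 1) \<longrightarrow>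
        (\<exists>C :: real. with_high_probability (\<lambda>n. noisy_space \<nu> (q n) n)
           (\<lambda>n \<omega>. \<forall>u v. long_edge d N (r n) n \<omega> u v \<longrightarrow>
              real (edge_clique_number {..<n} (noisy_edges d N (r n) n \<omega>) u v)
                \<le> C * log (1 / q n) (real n))))"
proof -
  \<comment> \<open>The least natural number with \<open>2 \<le> \<alpha> * real k\<close>; it
    depends on \<open>\<alpha>\<close> alone.\<close>
  define k where "k = nat \<lceil>2 / \<alpha>\<rceil>"
  have "2 / \<alpha> \<le> real k" unfolding k_def by linarith
  then have k: "2 \<le> \<alpha> * real k" using \<open>0 < \<alpha>\<close> by (simp add: field_simps)
  show ?thesis
  \<comment> \<open>All three constants \<open>C1\<close>, \<open>C2\<close> and
    \<open>\<xi>\<close> are taken to be 1.\<close>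
  proof (rule conjI; (rule exI[of _ "1::real"], rule conjI, simp)+; intro allI impI; elim conjE)
    fix d N \<nu> and r q :: "nat \<Rightarrow> real"
    assume set: "standard_setting d N \<nu> r" and q: "\<forall>n. 0 \<le> q n \<and> q n \<le> 1"
      and r: "\<forall>\<^sub>F n in sequentially. real n * r n ^ d \<le> real n powr (- \<alpha>)"
      and small: "\<forall>\<^sub>F n in sequentially. q n \<le> 1 * (1 / real n) powr 1"
    \<comment> \<open>Since \<open>real n * q n \<le> 1\<close>, the constant exponent 2 suffices,
      which yields \<open>K = 9 + k\<close>.\<close>
    have "\<forall>\<^sub>F n in sequentially. real n ^ 2 * q n ^ 2 \<le> 1 \<and> real (4 * 2 + 1 + k) \<le> real (9 + k)"
      using small eventually_gt_at_top[of 0]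
    proof eventually_elim
      case (elim n)
      then have "real n * q n \<le> 1" by (simp add: field_simps)
      then have "(real n * q n) ^ 2 \<le> 1" using q by (intro power_le_one) auto
      then show ?case by (simp add: power_mult_distrib)
    qed
    from with_high_probability_clique_bound[OF set \<open>0 < \<alpha>\<close> k _ r this] q
    show "\<exists>K. with_high_probability (\<lambda>n. noisy_space \<nu> (q n) n)
      (\<lambda>n \<omega>. \<forall>u v. long_edge d N (r n) n \<omega> u v \<longrightarrow>
        real (edge_clique_number {..<n} (noisy_edges d N (r n) n \<omega>) u v) \<le> K)" by blast
  next
    fix d N \<nu> and r q :: "nat \<Rightarrow> real"
    assume set: "standard_setting d N \<nu> r" and q: "\<forall>n. 0 \<le> q n \<and> q n \<le> 1"
      and r: "\<forall>\<^sub>F n in sequentially. real n * r n ^ d \<le> real n powr (- \<alpha>)"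
      and large: "\<forall>\<^sub>F n in sequentially. (1 / real n) powr 1 \<le> q n \<and> q n < 1"
    define L where "L n = log (1 / q n) (real n)" for n
    \<comment> \<open>As \<open>real n\<close> is \<open>1 / q n\<close> to the power
      \<open>L n\<close>, an exponent of at least \<open>2 * L n\<close> makes
      \<open>real n ^ 2 * q n ^ t n\<close> at most 1.\<close>
    define t where "t n = nat \<lceil>2 * L n\<rceil>" for n
    have "\<forall>\<^sub>F n in sequentially. real n ^ 2 * q n ^ t n \<le> 1 \<and>
        real (4 * t n + 1 + k) \<le> (13 + real k) * L n"
      using large eventually_gt_at_top[of 1]
    proof eventually_elim
      case (elim n)
      then have n: "real n > 1" and qn: "1 / real n \<le> q n" "q n < 1" by auto
      have q_pos: "q n > 0" using n by (intro less_le_trans[OF _ qn(1)]) simp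
      then have inv: "1 < 1 / q n" "1 / q n \<le> real n" using n qn by (auto simp: field_simps)
      \<comment> \<open>Here \<open>\<xi> = 1\<close> enters: \<open>1 / q n \<le> real n\<close>
        gives \<open>L n \<ge> 1\<close>. The additive constants in
        \<open>4 * t n + 1 + k \<le> 8 * L n + 5 + k\<close> are then absorbed into
        \<open>(13 + k) * L n\<close>.\<close>
      have "L n \<ge> log (1 / q n) (1 / q n)"
        unfolding L_def using inv n q_pos by (subst log_le_cancel_iff) auto
      then have L1: "L n \<ge> 1" using inv q_pos by (simp add: log_eq_one)
      have t: "2 * L n \<le> real (t n)" "real (t n) \<le> 2 * L n + 1"
        unfolding t_def using L1 by linarith+
      have "real n = (1 / q n) powr L n"
        unfolding L_def using inv n q_pos by (subst powr_log_cancel) auto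
      then have "real n ^ 2 = (1 / q n) powr (2 * L n)"
        using n by (simp add: powr_powr mult.commute flip: powr_numeral)
      also have "\<dots> \<le> (1 / q n) powr real (t n)"
        using inv t by (intro powr_mono) auto
      also have "\<dots> = 1 / q n ^ t n"
        using q_pos by (simp add: powr_realpow power_one_over)
      finally have "real n ^ 2 * q n ^ t n \<le> 1" using q_pos by (simp add: field_simps)
      moreover have "real k * 1 \<le> real k * L n" using L1 by (intro mult_left_mono) auto
      then have "real (4 * t n + 1 + k) \<le> (13 + real k) * L n"
        using t L1 by (simp add: algebra_simps)
      ultimately show ?case by blast
    qed
    from with_high_probability_clique_bound[OF set \<open>0 < \<alpha>\<close> k _ r this] q
    show "\<exists>C. with_high_probability (\<lambda>n. noisy_space \<nu> (q n) n)
      (\<lambda>n \<omega>. \<forall>u v. long_edge d N (r n) n \<omega> u v \<longrightarrow>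
        real (edge_clique_number {..<n} (noisy_edges d N (r n) n \<omega>) u v)
          \<le> C * log (1 / q n) (real n))" unfolding L_def by blast
  qed
qed

end
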